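(* (1) Let $H$ be a universal graph. Then $Y_H(\bullet)$ is a complete invariant for finite directed acyclic graphs (DAGs); that is, for any two finite DAGs $\vec{G}_1$ and $\vec{G}_2$, one has $Y_H(\vec{G}_1)=Y_H(\vec{G}_2)$ if and only if $\vec{G}_1$ and $\vec{G}_2$ are isomorphic as directed graphs. (2) Let $\{H_n\}_{n\in\mathbb{N}}$ be an infinite sequence of universal graphs. Then $\{Y_{H_n}(\bullet)\}_{n\in\mathbb{N}}$ is a complete invariant for finite DAGs; that is, for any two finite DAGs $\vec{G}_1$ and $\vec{G}_2$, one has $Y_{H_n}(\vec{G}_1)=Y_{H_n}(\vec{G}_2)$ for all $n\in\mathbb{N}$ if and only if $\vec{G}_1$ and $\vec{G}_2$ are isomorphic as directed graphs.
   Context: Undirected graphs are simple. An infinite graph $H$ is universal if it contains every finite graph as an induced subgraph (up to isomorphism). A homomorphism $\varphi:V(G)\to V(H)$ is a map such that $\{u,v\}\in E(G)$ implies $\{\varphi(u),\varphi(v)\}\in E(H)$; $\mathrm{Hom}(G,H)$ is the set of homomorphisms. For a finite graph $G$ with weight function $w:V(G)\to\{1,2,3,\dots\}$ and a graph $H$, with indeterminates $x=\{x_u\}_{u\in V(H)}$, define the formal power series $$X_H(G,w)=\sum_{\varphi\in\mathrm{Hom}(G,H)}\ \prod_{v\in V(G)}x_{\varphi(v)}^{w(v)}.$$ DAGs have no multiple arcs. For a finite DAG $\vec{G}$, let $G$ be the undirected graph obtained by forgetting directions, and define $w$ on $V(G)$ recursively by $w(v)=1$ if the in-degree of $v$ in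 $\vec{G}$ is $0$, and $w(v)=1+\max_{u:\,u\to v}w(u)$ otherwise. Put $Y_H(\vec{G})=X_H(G,w)$. *)

theory Defs
  imports
    "Graph_Theory.Graph_Theory"
    "HOL-Library.Poly_Mapping"
    "HOL-Library.FuncSet"
begin

text \<open>
  Undirected simple graphs, possibly infinite, are symmetric loop-free pair digraphs
  (\<^locale>\<open>pair_bidirected_digraph\<close>); the finite ones are \<^locale>\<open>pair_graph\<close>. An edge
  $\{u,v\}$ is the pair of arcs $(u,v)$, $(v,u)$. The graph with no vertices is allowed.
\<close>

text \<open>
  HOL cannot quantify over types inside a definition, so the finite graphs range over those with
  vertices in \<^typ>\<open>nat\<close>, which represent all isomorphism classes; see
  \<open>universal_graph_contains\<close> below.
\<close>

definition universal_graph :: "'h pair_pre_digraph \<Rightarrow> bool" where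
  "universal_graph H \<longleftrightarrow>
     pair_bidirected_digraph H \<and> infinite (pverts H) \<and>
     (\<forall>F :: nat pair_pre_digraph. pair_graph F \<longrightarrow>
        (\<exists>K. induced_subgraph (with_proj K) (with_proj H) \<and>
             digraph_iso (with_proj F) (with_proj K)))"

text \<open>Homomorphisms are extensional, so that each map on the vertex set is counted once.\<close>

definition Hom :: "'a pair_pre_digraph \<Rightarrow> 'h pair_pre_digraph \<Rightarrow> ('a \<Rightarrow> 'h) set" where
  "Hom G H = {\<phi> \<in> pverts G \<rightarrow>\<^sub>E pverts H. \<forall>(u, v) \<in> parcs G. (\<phi> u, \<phi> v) \<in> parcs H}"

text \<open>
  A power series in indeterminates indexed by \<^typ>\<open>'h\<close> is its coefficient function; a monomial
  is its finitely supported exponent vector, so products of monomials are sums of exponents.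
\<close>

type_synonym 'h power_series = "('h \<Rightarrow>\<^sub>0 nat) \<Rightarrow> int"

definition hom_monomial :: "'a pair_pre_digraph \<Rightarrow> ('a \<Rightarrow> nat) \<Rightarrow> ('a \<Rightarrow> 'h) \<Rightarrow> ('h \<Rightarrow>\<^sub>0 nat)" where
  "hom_monomial G w \<phi> = (\<Sum>v\<in>pverts G. Poly_Mapping.single (\<phi> v) (w v))"

text \<open>
  The coefficient of a monomial in the sum over all homomorphisms is the number of summands equal
  to it; \<open>finite_hom_monomial_fibre\<close> below shows that this number is finite.
\<close>

definition X_series ::
  "'h pair_pre_digraph \<Rightarrow> 'a pair_pre_digraph \<Rightarrow> ('a \<Rightarrow> nat) \<Rightarrow> 'h power_series" where
  "X_series H G w = (\<lambda>m. int (card {\<phi> \<in> Hom G H. hom_monomial G w \<phi> = m}))"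

definition finite_dag :: "'a pair_pre_digraph \<Rightarrow> bool" where
  "finite_dag D \<longleftrightarrow> pair_fin_digraph D \<and> acyclic (parcs D)"

text \<open>
  Well-founded recursion along the arcs; the recursion equation for finite DAGs is
  \<open>dag_weight_rec\<close> below.
\<close>

definition dag_weight :: "'a pair_pre_digraph \<Rightarrow> 'a \<Rightarrow> nat" where
  "dag_weight D = wfrec (parcs D)
     (\<lambda>w v. if in_degree (with_proj D) v = 0 then 1
            else 1 + Max (w ` {u. (u, v) \<in> parcs D}))"

definition Y_series :: "'h pair_pre_digraph \<Rightarrow> 'a pair_pre_digraph \<Rightarrow> 'h power_series" where
  "Y_series H D = X_series H (mk_symmetric (with_proj D)) (dag_weight D)"

lemma dag_weight_rec:
  assumes "finite_dag D"
  shows "dag_weight D v =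
    (if in_degree (with_proj D) v = 0 then 1
     else 1 + Max (dag_weight D ` {u. (u, v) \<in> parcs D}))"
proof -
  have "wf (parcs D)"
    using assms by (auto simp: finite_dag_def pair_fin_digraph_def pair_fin_digraph_axioms_def
        intro: finite_acyclic_wf)
  moreover have "cut f (parcs D) v ` {u. (u, v) \<in> parcs D} = f ` {u. (u, v) \<in> parcs D}"
    for f :: "'a \<Rightarrow> nat"
    by (auto simp: cut_apply image_iff)
  ultimately show ?thesis
    unfolding dag_weight_def by (subst wfrec) simp_all
qed

lemma dag_weight_pos:
  assumes "finite_dag D"
  shows "dag_weight D v \<ge> 1"
  by (subst dag_weight_rec[OF assms]) simp

lemma finite_hom_monomial_fibre:
  assumes fin: "finite (pverts G)" and w: "\<And>v. v \<in> pverts G \<Longrightarrow> w v \<ge> 1"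
  shows "finite {\<phi> \<in> Hom G H. hom_monomial G w \<phi> = m}"
proof (rule finite_subset)
  show "{\<phi> \<in> Hom G H. hom_monomial G w \<phi> = m} \<subseteq> pverts G \<rightarrow>\<^sub>E Poly_Mapping.keys m"
  proof
    fix \<phi> assume "\<phi> \<in> {\<phi> \<in> Hom G H. hom_monomial G w \<phi> = m}"
    then have "\<phi> \<in> Hom G H" and m: "hom_monomial G w \<phi> = m" by auto
    have "\<phi> v \<in> Poly_Mapping.keys (hom_monomial G w \<phi>)" if v: "v \<in> pverts G" for v
    proof -
      have "0 < w v" using w[OF v] by simp
      also have "\<dots> \<le> (\<Sum>u\<in>pverts G. Poly_Mapping.lookup (Poly_Mapping.single (\<phi> u) (w u)) (\<phi> v))"
        using member_le_sum[of v "pverts G"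
            "\<lambda>u. Poly_Mapping.lookup (Poly_Mapping.single (\<phi> u) (w u)) (\<phi> v)"] v fin
        by simp
      finally show ?thesis
        by (simp add: hom_monomial_def in_keys_iff lookup_sum)
    qed
    with \<open>\<phi> \<in> Hom G H\<close> show "\<phi> \<in> pverts G \<rightarrow>\<^sub>E Poly_Mapping.keys m"
      by (auto simp: Hom_def PiE_iff m)
  qed
  show "finite (pverts G \<rightarrow>\<^sub>E Poly_Mapping.keys m)"
    using fin by (intro finite_PiE) auto
qed

lemma universal_graph_contains:
  fixes H :: "'h pair_pre_digraph" and F :: "'a pair_pre_digraph"
  assumes H: "universal_graph H" and F: "pair_graph F"
  shows "\<exists>K. induced_subgraph (with_proj K) (with_proj H) \<and>
             digraph_iso (with_proj F) (with_proj K)"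
proof -
  interpret F: pair_graph F by fact
  obtain f :: "'a \<Rightarrow> nat" where f: "inj_on f (pverts F)"
    using finite_imp_inj_to_nat_seg[OF F.pair_finite_verts] by blast
  define N where "N = \<lparr>pverts = f ` pverts F, parcs = map_prod f f ` parcs F\<rparr>"
  define h where "h = \<lparr>iso_verts = f, iso_arcs = map_prod f f, iso_head = snd, iso_tail = fst\<rparr>"
  have neq: "f x \<noteq> f y" if "(x, y) \<in> parcs F" for x y
    using f F.no_loops'[OF that] F.in_arcsD1[OF that] F.in_arcsD2[OF that]
    by (simp add: inj_on_eq_iff)
  have N: "pair_graph N"
  proof
    show "symmetric (with_proj N)"
      unfolding symmetric_def N_def by (force intro!: symI dest: F.arcs_symmetric)
  qed (auto simp: N_def neq dest: F.in_arcsD1 F.in_arcsD2)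
  have inj: "inj_on (map_prod f f) (parcs F)"
    by (rule inj_on_subset[OF map_prod_inj_on[OF f f]]) (auto dest: F.in_arcsD1 F.in_arcsD2)
  have FN: "digraph_iso (with_proj F) (with_proj N)"
    unfolding digraph_iso_def pre_digraph.digraph_isomorphism_def
    using f inj F.wf_digraph
    by (intro exI[of _ h]) (auto simp: h_def N_def app_iso_def with_proj_def)
  from H N obtain K where K: "induced_subgraph (with_proj K) (with_proj H)"
      "digraph_iso (with_proj N) (with_proj K)"
    unfolding universal_graph_def by blast
  from K(2) obtain g where g: "pre_digraph.digraph_isomorphism (with_proj N) g"
      "with_proj K = app_iso g (with_proj N)"
    unfolding digraph_iso_def by blast
  define gh where "gh = \<lparr>iso_verts = iso_verts g \<circ> f, iso_arcs = iso_arcs g \<circ> map_prod f f,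
      iso_head = iso_head g, iso_tail = iso_tail g\<rparr>"
  have "digraph_iso (with_proj F) (with_proj K)"
    unfolding digraph_iso_def
  proof (intro exI[of _ gh] conjI)
    show "pre_digraph.digraph_isomorphism (with_proj F) gh"
      using f inj g(1) F.wf_digraph
      by (auto simp: pre_digraph.digraph_isomorphism_def gh_def N_def intro!: comp_inj_on)
    show "with_proj K = app_iso gh (with_proj F)"
      by (simp add: g(2) app_iso_def gh_def N_def image_comp)
  qed
  with K(1) show ?thesis by blast
qed

end

theory Submission
  imports Defs
begin

text \<open>
  Embed \<open>G1\<close> into the universal graph as an induced subgraph. The resulting monomial must also occur
  in the series of \<open>G2\<close>, and the homomorphism producing it factors through the embedding as a
  surjective homomorphism from \<open>G2\<close> to \<open>G1\<close> whose fibres add up to the weights of \<open>G1\<close>. By symmetry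
  the numbers of vertices agree, so such a homomorphism is a weight-preserving bijection in either
  direction; counting arcs makes it an isomorphism of the underlying graphs. The weight strictly
  increases along the arcs of a DAG, so the weights recover the orientation.
\<close>

section \<open>Isomorphisms and induced embeddings as vertex maps\<close>

text \<open>Tail and head are \<open>fst\<close> and \<open>snd\<close> on both sides, so the arc
  map of an isomorphism is forced to be \<open>map_prod f f\<close> for its vertex map
  \<open>f\<close>. This replaces the four-component isomorphism record by a single
  function.\<close>

lemma digraph_iso_with_proj_iff:
  fixes D1 :: "'a pair_pre_digraph" and D2 :: "'b pair_pre_digraph"
  assumes "pair_wf_digraph D1"
  shows "digraph_iso (with_proj D1) (with_proj D2) \<longleftrightarrow>
    (\<exists>f. bij_betw f (pverts D1) (pverts D2) \<and> parcs D2 = map_prod f f ` parcs D1)"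
proof
  interpret D1: pair_wf_digraph D1 by fact
  show "\<exists>f. bij_betw f (pverts D1) (pverts D2) \<and> parcs D2 = map_prod f f ` parcs D1"
    if "digraph_iso (with_proj D1) (with_proj D2)"
  proof -
    from that obtain h where h: "pre_digraph.digraph_isomorphism (with_proj D1) h"
        and D2: "with_proj D2 = app_iso h (with_proj D1)"
      unfolding digraph_iso_def by blast
    have eqs: "pverts D2 = iso_verts h ` pverts D1" "parcs D2 = iso_arcs h ` parcs D1"
        "iso_tail h = fst" "iso_head h = snd"
      using D2 by (auto simp: app_iso_def with_proj_def)
    have "iso_arcs h a = map_prod (iso_verts h) (iso_verts h) a" if "a \<in> parcs D1" for a
      using h that eqs by (auto simp: pre_digraph.digraph_isomorphism_def prod_eq_iff)
    then have "parcs D2 = map_prod (iso_verts h) (iso_verts h) ` parcs D1"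
      unfolding eqs(2) by (rule image_cong[OF refl])
    moreover have "bij_betw (iso_verts h) (pverts D1) (pverts D2)"
      using h eqs(1) by (simp add: bij_betw_def pre_digraph.digraph_isomorphism_def)
    ultimately show ?thesis by blast
  qed
  show "digraph_iso (with_proj D1) (with_proj D2)"
    if ex: "\<exists>f. bij_betw f (pverts D1) (pverts D2) \<and> parcs D2 = map_prod f f ` parcs D1"
  proof -
    from ex obtain f where f: "inj_on f (pverts D1)" "pverts D2 = f ` pverts D1"
        "parcs D2 = map_prod f f ` parcs D1"
      by (auto simp: bij_betw_def)
    define h where "h = \<lparr>iso_verts = f, iso_arcs = map_prod f f, iso_head = snd, iso_tail = fst\<rparr>"
    have "inj_on (map_prod f f) (parcs D1)"
      by (rule inj_on_subset[OF map_prod_inj_on[OF f(1) f(1)]])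
        (auto dest: D1.in_arcsD1 D1.in_arcsD2)
    then show ?thesis
      unfolding digraph_iso_def pre_digraph.digraph_isomorphism_def
      using f D1.wf_digraph
      by (intro exI[of _ h]) (auto simp: h_def app_iso_def with_proj_def)
  qed
qed

text \<open>The copy of \<open>F\<close> in \<open>H\<close> is induced, so its vertex map also
  reflects arcs. Reflection is what later allows arcs of \<open>H\<close> to be pulled back to
  \<open>F\<close>.\<close>

lemma universal_graph_embedding:
  fixes H :: "'h pair_pre_digraph" and F :: "'a pair_pre_digraph"
  assumes H: "universal_graph H" and F: "pair_graph F"
  obtains f where "inj_on f (pverts F)" "f ` pverts F \<subseteq> pverts H"
    "\<And>u v. u \<in> pverts F \<Longrightarrow> v \<in> pverts F \<Longrightarrow> (f u, f v) \<in> parcs H \<longleftrightarrow> (u, v) \<in> parcs F"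
proof -
  interpret F: pair_graph F by fact
  from universal_graph_contains[OF H F] obtain K where
    K: "induced_subgraph (with_proj K) (with_proj H)" "digraph_iso (with_proj F) (with_proj K)"
    by blast
  from K(2) obtain f where bij: "bij_betw f (pverts F) (pverts K)"
      and arcs: "parcs K = map_prod f f ` parcs F"
    unfolding digraph_iso_with_proj_iff[OF F.pair_wf_digraph_axioms] by blast
  have inj: "inj_on f (pverts F)" and img: "f ` pverts F = pverts K"
    using bij by (auto simp: bij_betw_def)
  have KH: "pverts K \<subseteq> pverts H" "parcs K = {(x, y) \<in> parcs H. x \<in> pverts K \<and> y \<in> pverts K}"
    using K(1) by (auto simp: induced_subgraph_def subgraph_def)
  have "(f u, f v) \<in> parcs H \<longleftrightarrow> (u, v) \<in> parcs F" if "u \<in> pverts F" "v \<in> pverts F" for u v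
  proof -
    have "(f u, f v) \<in> parcs H \<longleftrightarrow> (f u, f v) \<in> parcs K"
      using KH(2) img that by auto
    also have "\<dots> \<longleftrightarrow> (u, v) \<in> parcs F"
    proof
      assume "(f u, f v) \<in> parcs K"
      then obtain a b where ab: "(a, b) \<in> parcs F" "f u = f a" "f v = f b"
        unfolding arcs by auto
      with that inj have "u = a" "v = b"
        using F.in_arcsD1[OF ab(1)] F.in_arcsD2[OF ab(1)] by (auto dest: inj_onD)
      with ab show "(u, v) \<in> parcs F" by simp
    qed (force simp: arcs)
    finally show ?thesis .
  qed
  then show thesis using that inj img KH(1) by auto
qed

section \<open>Monomials of homomorphisms and coefficients of the series\<close>

lemma lookup_hom_monomial:
  assumes "finite (pverts G)"
  shows "Poly_Mapping.lookup (hom_monomial G w \<phi>) x = (\<Sum>v | v \<in> pverts G \<and> \<phi> v = x. w v)"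
proof -
  have "Poly_Mapping.lookup (hom_monomial G w \<phi>) x = (\<Sum>v\<in>pverts G. if \<phi> v = x then w v else 0)"
    unfolding hom_monomial_def lookup_sum
    by (intro sum.cong) (auto simp: lookup_single when_def)
  then show ?thesis
    using assms by (simp add: sum.inter_filter)
qed

text \<open>With positive weights, every vertex contributes to the exponent at its image, so the
  support of the monomial determines the image of the map.\<close>

lemma keys_hom_monomial:
  assumes fin: "finite (pverts G)" and w: "\<And>v. v \<in> pverts G \<Longrightarrow> w v \<ge> 1"
  shows "Poly_Mapping.keys (hom_monomial G w \<phi>) = \<phi> ` pverts G"
proof -
  have "w v \<noteq> 0" if "v \<in> pverts G" for v
    using w[OF that] by simp
  then have "(\<Sum>v | v \<in> pverts G \<and> \<phi> v = x. w v) \<noteq> 0 \<longleftrightarrow> x \<in> \<phi> ` pverts G" for x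
    using fin by auto
  then show ?thesis
    using fin by (auto simp: in_keys_iff lookup_hom_monomial)
qed

text \<open>Three features of the common monomial are used: its coefficient is nonzero, which yields
  a homomorphism from \<open>G2\<close>; its support fixes the image, so that the map can be pulled
  back to \<open>G1\<close>; its exponents give the fibre sums.\<close>

lemma weighted_hom_of_X_series_eq:
  fixes H :: "'h pair_pre_digraph" and G1 :: "'a pair_pre_digraph" and G2 :: "'b pair_pre_digraph"
  assumes H: "universal_graph H" and G1: "pair_graph G1" and fin2: "finite (pverts G2)"
    and w1: "\<And>v. v \<in> pverts G1 \<Longrightarrow> w1 v \<ge> 1" and w2: "\<And>v. v \<in> pverts G2 \<Longrightarrow> w2 v \<ge> 1"
    and eq: "X_series H G1 w1 = X_series H G2 w2" and wf2: "pair_wf_digraph G2"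
  obtains \<psi> where "\<psi> ` pverts G2 = pverts G1"
    "\<And>u v. (u, v) \<in> parcs G2 \<Longrightarrow> (\<psi> u, \<psi> v) \<in> parcs G1"
    "\<And>u. u \<in> pverts G1 \<Longrightarrow> w1 u = (\<Sum>v | v \<in> pverts G2 \<and> \<psi> v = u. w2 v)"
proof -
  interpret G1: pair_graph G1 by fact
  interpret G2: pair_wf_digraph G2 by fact
  have fin1: "finite (pverts G1)" by simp
  obtain f where inj: "inj_on f (pverts G1)" and fH: "f ` pverts G1 \<subseteq> pverts H"
    and f: "\<And>u v. u \<in> pverts G1 \<Longrightarrow> v \<in> pverts G1 \<Longrightarrow> (f u, f v) \<in> parcs H \<longleftrightarrow> (u, v) \<in> parcs G1"
    using universal_graph_embedding[OF H G1] by blast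
  \<comment> \<open>Elements of \<open>Hom\<close> are extensional, so the embedding is cut down to
    the vertex set.\<close>
  define F where "F = restrict f (pverts G1)"
  have F_hom: "F \<in> Hom G1 H"
    using fH f by (auto simp: Hom_def F_def dest: G1.in_arcsD1 G1.in_arcsD2)
  define m where "m = hom_monomial G1 w1 F"
  \<comment> \<open>The witness \<open>F\<close> alone does not suffice, since \<open>card\<close>
    is 0 on infinite sets; finiteness of the fibre enters here.\<close>
  have "X_series H G1 w1 m \<noteq> 0"
    using finite_hom_monomial_fibre[of G1 w1 H m] fin1 w1 F_hom
    by (auto simp: X_series_def m_def card_eq_0_iff)
  then have "X_series H G2 w2 m \<noteq> 0" using eq by simp
  then have "{\<phi> \<in> Hom G2 H. hom_monomial G2 w2 \<phi> = m} \<noteq> {}"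
    unfolding X_series_def by (metis card.empty of_nat_0)
  then obtain \<phi> where \<phi>: "\<phi> \<in> Hom G2 H" "hom_monomial G2 w2 \<phi> = m" by blast
  have img: "\<phi> ` pverts G2 = f ` pverts G1"
    using keys_hom_monomial[of G2 w2 \<phi>] keys_hom_monomial[of G1 w1 F] fin1 fin2 w1 w2 \<phi>(2)
    by (simp add: m_def F_def)
  \<comment> \<open>By \<open>img\<close>, every value of \<open>\<phi>\<close> on
    \<open>pverts G2\<close> lies in the copy of \<open>G1\<close>, so the embedding can be inverted
    on it.\<close>
  define \<psi> where "\<psi> = inv_into (pverts G1) f \<circ> \<phi>"
  have \<psi>: "\<psi> v \<in> pverts G1" "f (\<psi> v) = \<phi> v" if "v \<in> pverts G2" for v
    using imageI[OF that, of \<phi>] unfolding img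
    by (simp_all add: \<psi>_def inv_into_into f_inv_into_f)
  show thesis
  proof
    show "\<psi> ` pverts G2 = pverts G1"
      unfolding \<psi>_def image_comp[symmetric] img using inj by (simp add: inv_into_image_cancel)
    show "(\<psi> u, \<psi> v) \<in> parcs G1" if uv: "(u, v) \<in> parcs G2" for u v
    proof -
      have "u \<in> pverts G2" "v \<in> pverts G2" "(\<phi> u, \<phi> v) \<in> parcs H"
        using uv \<phi>(1) by (auto simp: Hom_def dest: G2.in_arcsD1 G2.in_arcsD2)
      then show ?thesis using \<psi> f by metis
    qed
    show "w1 u = (\<Sum>v | v \<in> pverts G2 \<and> \<psi> v = u. w2 v)" if u: "u \<in> pverts G1" for u
    proof -
      \<comment> \<open>As \<open>f\<close> is injective, the exponent of \<open>m\<close> at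
        \<open>f u\<close> is the single weight \<open>w1 u\<close>; the same exponent computed
        through \<open>\<phi>\<close> is the fibre sum.\<close>
      have "{v. v \<in> pverts G1 \<and> F v = f u} = {u}"
        using u inj by (auto simp: F_def inj_on_eq_iff)
      then have "w1 u = Poly_Mapping.lookup m (f u)"
        by (simp add: m_def lookup_hom_monomial)
      also have "\<dots> = (\<Sum>v | v \<in> pverts G2 \<and> \<phi> v = f u. w2 v)"
        using \<phi>(2) lookup_hom_monomial[OF fin2, of w2 \<phi>] by simp
      also have "{v. v \<in> pverts G2 \<and> \<phi> v = f u} = {v. v \<in> pverts G2 \<and> \<psi> v = u}"
        using \<psi> u inj by (auto simp: inj_on_eq_iff) (metis inj_on_eq_iff)
      finally show ?thesis .
    qed
  qed
qed

text \<open>Precomposition with \<open>f\<close> matches the homomorphisms counted by corresponding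
  coefficients; the inverse is precomposition with the inverse of \<open>f\<close>.\<close>

lemma X_series_iso:
  assumes wf1: "pair_wf_digraph G1" and bij: "bij_betw f (pverts G1) (pverts G2)"
    and arcs: "parcs G2 = map_prod f f ` parcs G1"
    and w: "\<And>v. v \<in> pverts G1 \<Longrightarrow> w2 (f v) = w1 v"
  shows "X_series H G1 w1 = X_series H G2 w2"
proof
  fix m
  interpret G1: pair_wf_digraph G1 by fact
  let ?A = "{\<phi> \<in> Hom G1 H. hom_monomial G1 w1 \<phi> = m}"
  let ?B = "{\<phi> \<in> Hom G2 H. hom_monomial G2 w2 \<phi> = m}"
  define g where "g = inv_into (pverts G1) f"
  have f: "f v \<in> pverts G2" "g (f v) = v" if "v \<in> pverts G1" for v
    using that bij by (auto simp: g_def bij_betw_def)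
  have g: "g v \<in> pverts G1" "f (g v) = v" if "v \<in> pverts G2" for v
    using that bij by (auto simp: g_def bij_betw_def f_inv_into_f inv_into_into)
  \<comment> \<open>Agreement is only required on the vertices, so that both restricted compositions
    below are covered.\<close>
  have monomial: "hom_monomial G2 w2 \<phi> = hom_monomial G1 w1 \<phi>'"
    if "\<And>v. v \<in> pverts G1 \<Longrightarrow> \<phi>' v = \<phi> (f v)" for \<phi> :: "'b \<Rightarrow> 'h" and \<phi>'
    unfolding hom_monomial_def sum.reindex_bij_betw[OF bij, symmetric]
    using w that by (intro sum.cong) auto
  have "bij_betw (\<lambda>\<phi>. restrict (\<phi> \<circ> f) (pverts G1)) ?B ?A"
  proof (rule bij_betw_byWitness[where f' = "\<lambda>\<phi>. restrict (\<phi> \<circ> g) (pverts G2)"])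
    show "\<forall>\<phi>\<in>?B. restrict (restrict (\<phi> \<circ> f) (pverts G1) \<circ> g) (pverts G2) = \<phi>"
      using g by (auto simp: Hom_def PiE_iff extensional_def fun_eq_iff)
    show "\<forall>\<phi>\<in>?A. restrict (restrict (\<phi> \<circ> g) (pverts G2) \<circ> f) (pverts G1) = \<phi>"
      using f by (auto simp: Hom_def PiE_iff extensional_def fun_eq_iff)
    show "(\<lambda>\<phi>. restrict (\<phi> \<circ> f) (pverts G1)) ` ?B \<subseteq> ?A"
    proof (intro image_subsetI CollectI conjI)
      fix \<phi> assume \<phi>: "\<phi> \<in> ?B"
      then show "restrict (\<phi> \<circ> f) (pverts G1) \<in> Hom G1 H"
        using f by (fastforce simp: Hom_def arcs dest: G1.in_arcsD1 G1.in_arcsD2)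
      show "hom_monomial G1 w1 (restrict (\<phi> \<circ> f) (pverts G1)) = m"
        using \<phi> monomial[of "restrict (\<phi> \<circ> f) (pverts G1)" \<phi>] by simp
    qed
    show "(\<lambda>\<phi>. restrict (\<phi> \<circ> g) (pverts G2)) ` ?A \<subseteq> ?B"
    proof (intro image_subsetI CollectI conjI)
      fix \<phi> assume \<phi>: "\<phi> \<in> ?A"
      have "(\<phi> (g x), \<phi> (g y)) \<in> parcs H \<and> x \<in> pverts G2 \<and> y \<in> pverts G2"
        if xy: "(x, y) \<in> parcs G2" for x y
      proof -
        obtain u v where uv: "(u, v) \<in> parcs G1" "x = f u" "y = f v"
          using xy unfolding arcs by auto
        then show ?thesis
          using f \<phi> G1.in_arcsD1[OF uv(1)] G1.in_arcsD2[OF uv(1)] by (auto simp: Hom_def)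
      qed
      then show "restrict (\<phi> \<circ> g) (pverts G2) \<in> Hom G2 H"
        using \<phi> g by (auto simp: Hom_def PiE_iff)
      show "hom_monomial G2 w2 (restrict (\<phi> \<circ> g) (pverts G2)) = m"
        using \<phi> monomial[of \<phi> "restrict (\<phi> \<circ> g) (pverts G2)"] f by simp
    qed
  qed
  then show "X_series H G1 w1 m = X_series H G2 w2 m"
    by (simp add: X_series_def bij_betw_same_card)
qed

section \<open>Weights of DAGs\<close>

text \<open>The in-degree is a cardinality; finiteness of the arc set makes its vanishing the same
  as having no predecessor.\<close>

lemma dag_weight_eq:
  assumes "finite_dag D"
  shows "dag_weight D v = (if {u. (u, v) \<in> parcs D} = {} then 1
    else 1 + Max (dag_weight D ` {u. (u, v) \<in> parcs D}))"
proof -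
  interpret pair_fin_digraph D using assms by (simp add: finite_dag_def)
  have "finite (in_arcs (with_proj D) v)"
    by (rule finite_subset[OF _ pair_finite_arcs]) auto
  then have "in_degree (with_proj D) v = 0 \<longleftrightarrow> {u. (u, v) \<in> parcs D} = {}"
    by (auto simp: in_degree_def in_arcs_def)
  then show ?thesis using dag_weight_rec[OF assms, of v] by simp
qed

lemma dag_weight_less:
  assumes D: "finite_dag D" and uv: "(u, v) \<in> parcs D"
  shows "dag_weight D u < dag_weight D v"
proof -
  interpret pair_fin_digraph D using D by (simp add: finite_dag_def)
  have "finite {u. (u, v) \<in> parcs D}"
    by (rule finite_subset[OF _ pair_finite_verts]) (auto dest: in_arcsD1)
  then have "dag_weight D u \<le> Max (dag_weight D ` {u. (u, v) \<in> parcs D})"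
    using uv by (intro Max_ge) auto
  then show ?thesis using uv by (subst dag_weight_eq[OF D, of v]) auto
qed

text \<open>Well-founded induction along the arcs: \<open>f\<close> carries the predecessors of
  \<open>v\<close> exactly onto those of \<open>f v\<close>, so both recursions take the same
  maximum.\<close>

lemma dag_weight_iso:
  assumes D1: "finite_dag D1" and D2: "finite_dag D2"
    and bij: "bij_betw f (pverts D1) (pverts D2)" and arcs: "parcs D2 = map_prod f f ` parcs D1"
    and v: "v \<in> pverts D1"
  shows "dag_weight D2 (f v) = dag_weight D1 v"
proof -
  interpret D1: pair_fin_digraph D1 using D1 by (simp add: finite_dag_def)
  have "wf (parcs D1)"
    using D1 by (auto simp: finite_dag_def intro: finite_acyclic_wf)
  then show ?thesis using v
  proof (induction v rule: wf_induct_rule)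
    case (less v)
    \<comment> \<open>This ensures that an arc into \<open>f v\<close> can only come from an arc
      into \<open>v\<close>.\<close>
    have "f a = f v \<longleftrightarrow> a = v" if "a \<in> pverts D1" for a
      using bij less.prems that by (auto simp: bij_betw_def inj_on_eq_iff)
    then have preds: "{u. (u, f v) \<in> parcs D2} = f ` {u. (u, v) \<in> parcs D1}"
      unfolding arcs by (force dest: D1.in_arcsD2)
    have "dag_weight D2 ` f ` {u. (u, v) \<in> parcs D1} = dag_weight D1 ` {u. (u, v) \<in> parcs D1}"
      unfolding image_comp using less.IH by (intro image_cong) (auto dest: D1.in_arcsD1)
    then show ?case
      unfolding dag_weight_eq[OF D2, of "f v"] dag_weight_eq[OF D1, of v] preds by simp
  qed
qed

section \<open>The underlying graph and invariance of the series\<close>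

lemma parcs_mk_symmetric_with_proj:
  "parcs (mk_symmetric (with_proj D)) = parcs D \<union> (parcs D)\<inverse>"
  by (auto simp: parcs_mk_symmetric)

lemma pair_graph_mk_symmetric_dag:
  assumes D: "finite_dag D"
  shows "pair_graph (mk_symmetric (with_proj D))"
proof -
  interpret D: pair_fin_digraph D using D by (simp add: finite_dag_def)
  show ?thesis
  proof
    show "symmetric (with_proj (mk_symmetric (with_proj D)))"
      by (auto simp: symmetric_def parcs_mk_symmetric_with_proj intro!: symI)
  \<comment> \<open>A loop would make the weight of a vertex smaller than itself.\<close>
  qed (use dag_weight_less[OF D] in
      \<open>fastforce simp: parcs_mk_symmetric_with_proj dest: D.in_arcsD1 D.in_arcsD2\<close>)+
qed

lemma Y_series_iso:
  assumes D1: "finite_dag D1" and D2: "finite_dag D2"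
    and iso: "digraph_iso (with_proj D1) (with_proj D2)"
  shows "Y_series H D1 = Y_series H D2"
proof -
  interpret D1: pair_fin_digraph D1 using D1 by (simp add: finite_dag_def)
  interpret G1: pair_graph "mk_symmetric (with_proj D1)"
    by (rule pair_graph_mk_symmetric_dag[OF D1])
  obtain f where f: "bij_betw f (pverts D1) (pverts D2)" "parcs D2 = map_prod f f ` parcs D1"
    using iso unfolding digraph_iso_with_proj_iff[OF D1.pair_wf_digraph_axioms] by blast
  show ?thesis
    unfolding Y_series_def
  proof (rule X_series_iso[where f = f])
    show "pair_wf_digraph (mk_symmetric (with_proj D1))" ..
    show "parcs (mk_symmetric (with_proj D2)) =
        map_prod f f ` parcs (mk_symmetric (with_proj D1))"
      unfolding parcs_mk_symmetric_with_proj f(2) by force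
  qed (use f dag_weight_iso[OF D1 D2 f] in auto)
qed

section \<open>Recovering the DAG from its series\<close>

text \<open>The general result for weighted graphs, applied to the underlying graphs. At this stage
  \<open>\<psi>\<close> respects arcs only up to reversal.\<close>

lemma weighted_hom_of_Y_series_eq:
  fixes H :: "'h pair_pre_digraph" and D1 :: "'a pair_pre_digraph" and D2 :: "'b pair_pre_digraph"
  assumes H: "universal_graph H" and D1: "finite_dag D1" and D2: "finite_dag D2"
    and eq: "Y_series H D1 = Y_series H D2"
  obtains \<psi> where "\<psi> ` pverts D2 = pverts D1"
    "\<And>u v. (u, v) \<in> parcs D2 \<Longrightarrow> (\<psi> u, \<psi> v) \<in> parcs D1 \<union> (parcs D1)\<inverse>"
    "\<And>u. u \<in> pverts D1 \<Longrightarrow>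
      dag_weight D1 u = (\<Sum>v | v \<in> pverts D2 \<and> \<psi> v = u. dag_weight D2 v)"
proof -
  let ?G1 = "mk_symmetric (with_proj D1)" and ?G2 = "mk_symmetric (with_proj D2)"
  interpret G1: pair_graph ?G1 by (rule pair_graph_mk_symmetric_dag[OF D1])
  interpret G2: pair_graph ?G2 by (rule pair_graph_mk_symmetric_dag[OF D2])
  obtain \<psi> where "\<psi> ` pverts ?G2 = pverts ?G1"
    "\<And>u v. (u, v) \<in> parcs ?G2 \<Longrightarrow> (\<psi> u, \<psi> v) \<in> parcs ?G1"
    "\<And>u. u \<in> pverts ?G1 \<Longrightarrow>
      dag_weight D1 u = (\<Sum>v | v \<in> pverts ?G2 \<and> \<psi> v = u. dag_weight D2 v)"
    using weighted_hom_of_X_series_eq[OF H G1.pair_graph_axioms G2.pair_finite_verts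
        dag_weight_pos[OF D1] dag_weight_pos[OF D2] eq[unfolded Y_series_def]
        G2.pair_wf_digraph_axioms]
    by blast
  then show thesis
    using that[of \<psi>] by (auto simp: parcs_mk_symmetric_with_proj)
qed

lemma bijective_hom_of_Y_series_eq:
  fixes H :: "'h pair_pre_digraph" and D1 :: "'a pair_pre_digraph" and D2 :: "'b pair_pre_digraph"
  assumes H: "universal_graph H" and D1: "finite_dag D1" and D2: "finite_dag D2"
    and eq: "Y_series H D1 = Y_series H D2"
  obtains \<psi> where "bij_betw \<psi> (pverts D2) (pverts D1)" "map_prod \<psi> \<psi> ` parcs D2 \<subseteq> parcs D1"
proof -
  interpret D1: pair_fin_digraph D1 using D1 by (simp add: finite_dag_def)
  interpret D2: pair_fin_digraph D2 using D2 by (simp add: finite_dag_def)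
  obtain \<psi> where \<psi>: "\<psi> ` pverts D2 = pverts D1"
    "\<And>u v. (u, v) \<in> parcs D2 \<Longrightarrow> (\<psi> u, \<psi> v) \<in> parcs D1 \<union> (parcs D1)\<inverse>"
    "\<And>u. u \<in> pverts D1 \<Longrightarrow>
      dag_weight D1 u = (\<Sum>v | v \<in> pverts D2 \<and> \<psi> v = u. dag_weight D2 v)"
    using weighted_hom_of_Y_series_eq[OF H D1 D2 eq] by blast
  \<comment> \<open>Surjectivity in the reverse direction supplies the second cardinality
    inequality.\<close>
  obtain \<chi> where \<chi>: "\<chi> ` pverts D1 = pverts D2"
    by (rule weighted_hom_of_Y_series_eq[OF H D2 D1 eq[symmetric]]) blast
  have "card (pverts D2) \<le> card (pverts D1)" "card (pverts D1) \<le> card (pverts D2)"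
    using card_image_le[of "pverts D1" \<chi>] card_image_le[of "pverts D2" \<psi>] \<psi>(1) \<chi> by auto
  then have inj: "inj_on \<psi> (pverts D2)"
    using \<psi>(1) by (intro eq_card_imp_inj_on) auto
  have weight: "dag_weight D1 (\<psi> v) = dag_weight D2 v" if "v \<in> pverts D2" for v
  proof -
    \<comment> \<open>With singleton fibres, the fibre sum in \<open>\<psi>(3)\<close> collapses to
      one weight.\<close>
    have "{v'. v' \<in> pverts D2 \<and> \<psi> v' = \<psi> v} = {v}"
      using inj that by (auto simp: inj_on_eq_iff)
    then show ?thesis using \<psi>(1) \<psi>(3)[of "\<psi> v"] that by auto
  qed
  \<comment> \<open>A reversed arc would force the weight to drop from \<open>\<psi> u\<close> to
    \<open>\<psi> v\<close>, whereas it grows from \<open>u\<close> to \<open>v\<close> and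
    \<open>\<psi>\<close> preserves it.\<close>
  have "(\<psi> u, \<psi> v) \<in> parcs D1" if uv: "(u, v) \<in> parcs D2" for u v
    using \<psi>(2)[OF uv] dag_weight_less[OF D2 uv] dag_weight_less[OF D1, of "\<psi> v" "\<psi> u"]
      weight D2.in_arcsD1[OF uv] D2.in_arcsD2[OF uv]
    by fastforce
  then show thesis
    using that[of \<psi>] inj \<psi>(1) by (auto simp: bij_betw_def)
qed

text \<open>Injectivity on vertices passes to arcs. Used in both directions, this forces equal arc
  counts.\<close>

lemma card_parcs_injective_hom:
  assumes "pair_fin_digraph D1" "pair_fin_digraph D2" "inj_on \<psi> (pverts D2)"
    "map_prod \<psi> \<psi> ` parcs D2 \<subseteq> parcs D1"
  shows "card (parcs D2) = card (map_prod \<psi> \<psi> ` parcs D2)" "card (parcs D2) \<le> card (parcs D1)"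
proof -
  interpret D1: pair_fin_digraph D1 by fact
  interpret D2: pair_fin_digraph D2 by fact
  have "inj_on (map_prod \<psi> \<psi>) (parcs D2)"
    by (rule inj_on_subset[OF map_prod_inj_on[OF assms(3) assms(3)]])
      (auto dest: D2.in_arcsD1 D2.in_arcsD2)
  then show "card (parcs D2) = card (map_prod \<psi> \<psi> ` parcs D2)"
    by (simp add: card_image)
  then show "card (parcs D2) \<le> card (parcs D1)"
    using card_mono[OF D1.pair_finite_arcs assms(4)] by simp
qed

text \<open>A bijective homomorphism may miss arcs of its target. Having one in each direction
  equates the finite arc counts, so no arc is missed.\<close>

lemma Y_series_eq_imp_iso:
  fixes H :: "'h pair_pre_digraph" and D1 :: "'a pair_pre_digraph" and D2 :: "'b pair_pre_digraph"
  assumes H: "universal_graph H" and D1: "finite_dag D1" and D2: "finite_dag D2"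
    and eq: "Y_series H D1 = Y_series H D2"
  shows "digraph_iso (with_proj D1) (with_proj D2)"
proof -
  have fin: "pair_fin_digraph D1" "pair_fin_digraph D2"
    using D1 D2 by (auto simp: finite_dag_def)
  interpret D1: pair_fin_digraph D1 by (rule fin)
  interpret D2: pair_fin_digraph D2 by (rule fin)
  obtain \<psi> where \<psi>: "bij_betw \<psi> (pverts D2) (pverts D1)" "map_prod \<psi> \<psi> ` parcs D2 \<subseteq> parcs D1"
    using bijective_hom_of_Y_series_eq[OF H D1 D2 eq] by blast
  obtain \<chi> where \<chi>: "bij_betw \<chi> (pverts D1) (pverts D2)" "map_prod \<chi> \<chi> ` parcs D1 \<subseteq> parcs D2"
    using bijective_hom_of_Y_series_eq[OF H D2 D1 eq[symmetric]] by blast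
  have "card (parcs D2) = card (map_prod \<chi> \<chi> ` parcs D1)"
    using card_parcs_injective_hom[OF fin bij_betw_imp_inj_on[OF \<psi>(1)] \<psi>(2)]
      card_parcs_injective_hom[OF fin(2,1) bij_betw_imp_inj_on[OF \<chi>(1)] \<chi>(2)]
    by simp
  then have "parcs D2 = map_prod \<chi> \<chi> ` parcs D1"
    using card_subset_eq[OF D2.pair_finite_arcs \<chi>(2)] by simp
  with \<chi>(1) show ?thesis
    unfolding digraph_iso_with_proj_iff[OF D1.pair_wf_digraph_axioms] by blast
qed

theorem theorem5p1:
  shows
    "(\<forall>H :: 'h pair_pre_digraph. universal_graph H \<longrightarrow>
        (\<forall>(D1 :: 'a pair_pre_digraph) (D2 :: 'b pair_pre_digraph).
           finite_dag D1 \<and> finite_dag D2 \<longrightarrow>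
           (Y_series H D1 = Y_series H D2 \<longleftrightarrow>
            digraph_iso (with_proj D1) (with_proj D2)))) \<and>
     (\<forall>H :: nat \<Rightarrow> 'h pair_pre_digraph. (\<forall>n. universal_graph (H n)) \<longrightarrow>
        (\<forall>(D1 :: 'a pair_pre_digraph) (D2 :: 'b pair_pre_digraph).
           finite_dag D1 \<and> finite_dag D2 \<longrightarrow>
           ((\<forall>n. Y_series (H n) D1 = Y_series (H n) D2) \<longleftrightarrow>
            digraph_iso (with_proj D1) (with_proj D2))))"
  \<comment> \<open>For a sequence, the forward direction instantiates the equality at one index and
    the converse holds at each index separately.\<close>
  using Y_series_eq_imp_iso Y_series_iso by blast

end
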